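(* Let $L$ be a bounded lattice and let $\to$ be a preconditional on $L$. For $a\in L$ let $\widehat{a}=\{(F,I)\in X\mid a\in F\}$, where $\mathsf{FI}(L,\to)=(X,\vartriangleleft)$ is the relational frame of consonant filter-ideal pairs of $(L,\to)$. Then the map $a\mapsto\widehat{a}$ is 1. an embedding of $(L,\to)$ into $(\mathfrak{L}(\mathsf{FI}(L,\to)),\to_\vartriangleleft)$ (as bounded lattices with an additional binary operation), and 2. an isomorphism from $L$ to the subalgebra of $(\mathfrak{L}(\mathsf{FI}(L,\to)),\to_\vartriangleleft)$ consisting of those elements of $\mathfrak{L}(\mathsf{FI}(L,\to))$ that are compact open in the space $\mathsf{S}(L,\to)$.
   Context: A preconditional on a bounded lattice $L$ is a binary operation $\to$ on $L$ such that for all $a,b,c\in L$: (1) $1\to a\leq a$; (2) $a\wedge b\leq a\to b$; (3) $a\to b\leq a\to(a\wedge b)$; (4) $a\to(b\wedge c)\leq a\to b$; (5) $a\to((a\wedge b)\to c)\leq (a\wedge b)\to c$. Given a set $X$ and a binary relation $\vartriangleleft$ on $X$, with converse $\vartriangleright$, define for $A,B\subseteq X$ $$A\to_\vartriangleleft B=\{x\in X\mid \forall y\vartriangleleft x\,(y\in A\Rightarrow \exists z\vartriangleright y:\ z\in A\cap B)\}.$$ The map $c_\vartriangleleft(A)=X\to_\vartriangleleft A$ is a closure operator on $\wp(X)$. $\mathfrak{L}(X,\vartriangleleft)$ is the complete lattice of its fixpoints ordered by inclusion, with meet given by intersection, join $\bigvee_\vartriangleleft\{A_i\mid i\in I\}=c_\vartriangleleft(\bigcup\{A_i\mid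 i\in I\})$, top $X$ and bottom $c_\vartriangleleft(\varnothing)$. It is closed under $\to_\vartriangleleft$, so $\to_\vartriangleleft$ is regarded as an operation on it. Given a bounded lattice $L$ with preconditional $\to$, a consonant filter-ideal pair is a pair $(F,I)$ with $F$ a filter in $L$ and $I$ an ideal in $L$ (filters and ideals are not required to be proper) such that for all $a,b\in L$: if $a\in F$ and $a\wedge b\in I$, then $a\to b\in I$. The frame $\mathsf{FI}(L,\to)=(X,\vartriangleleft)$ has $X$ the set of all consonant filter-ideal pairs of $L$, with $(F,I)\vartriangleleft(F',I')$ iff $I\cap F'=\varnothing$. $\mathsf{S}(L,\to)$ is $\mathsf{FI}(L,\to)$ endowed with the topology generated by $\{\widehat{a}\mid a\in L\}$. *)

theory Defs
  imports "HOL-Analysis.Abstract_Topology"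
begin

record 'a lat_algebra =
  Carrier :: "'a set"
  Meet :: "'a \<Rightarrow> 'a \<Rightarrow> 'a"
  Join :: "'a \<Rightarrow> 'a \<Rightarrow> 'a"
  Top :: "'a"
  Bot :: "'a"
  Imp :: "'a \<Rightarrow> 'a \<Rightarrow> 'a"

definition lat_hom :: "'a lat_algebra \<Rightarrow> 'b lat_algebra \<Rightarrow> ('a \<Rightarrow> 'b) \<Rightarrow> bool" where
  "lat_hom A B f \<longleftrightarrow>
     f ` Carrier A \<subseteq> Carrier B \<and>
     f (Top A) = Top B \<and>
     f (Bot A) = Bot B \<and>
     (\<forall>x\<in>Carrier A. \<forall>y\<in>Carrier A.
        f (Meet A x y) = Meet B (f x) (f y) \<and>
        f (Join A x y) = Join B (f x) (f y) \<and>
        f (Imp A x y) = Imp B (f x) (f y))"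

definition lat_embedding :: "'a lat_algebra \<Rightarrow> 'b lat_algebra \<Rightarrow> ('a \<Rightarrow> 'b) \<Rightarrow> bool" where
  "lat_embedding A B f \<longleftrightarrow> lat_hom A B f \<and> inj_on f (Carrier A)"

definition lat_iso :: "'a lat_algebra \<Rightarrow> 'b lat_algebra \<Rightarrow> ('a \<Rightarrow> 'b) \<Rightarrow> bool" where
  "lat_iso A B f \<longleftrightarrow> lat_hom A B f \<and> bij_betw f (Carrier A) (Carrier B)"

definition lat_subalgebra :: "'a set \<Rightarrow> 'a lat_algebra \<Rightarrow> bool" where
  "lat_subalgebra S A \<longleftrightarrow>
     S \<subseteq> Carrier A \<and> Top A \<in> S \<and> Bot A \<in> S \<and>
     (\<forall>x\<in>S. \<forall>y\<in>S. Meet A x y \<in> S \<and> Join A x y \<in> S \<and> Imp A x y \<in> S)"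

definition type_algebra :: "('a::bounded_lattice \<Rightarrow> 'a \<Rightarrow> 'a) \<Rightarrow> 'a lat_algebra" where
  "type_algebra imp =
     \<lparr>Carrier = UNIV, Meet = inf, Join = sup, Top = top, Bot = bot, Imp = imp\<rparr>"

locale preconditional =
  fixes imp :: "'a::bounded_lattice \<Rightarrow> 'a \<Rightarrow> 'a"  (infixr "\<leadsto>" 60)
  assumes top_imp: "top \<leadsto> a \<le> a"
    and inf_le_imp: "inf a b \<le> a \<leadsto> b"
    and imp_le_imp_inf: "a \<leadsto> b \<le> a \<leadsto> inf a b"
    and imp_inf_le: "a \<leadsto> inf b c \<le> a \<leadsto> b"
    and imp_imp_le: "a \<leadsto> (inf a b \<leadsto> c) \<le> inf a b \<leadsto> c"

text \<open>A frame is a set \<open>X\<close> with a relation \<open>R\<close>, where \<open>R y x\<close> reads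
  \<open>y \<triangleleft> x\<close>; only the restriction of \<open>R\<close> to \<open>X\<close> matters.\<close>

definition frame_imp :: "'x set \<Rightarrow> ('x \<Rightarrow> 'x \<Rightarrow> bool) \<Rightarrow> 'x set \<Rightarrow> 'x set \<Rightarrow> 'x set" where
  "frame_imp X R A B =
     {x \<in> X. \<forall>y\<in>X. R y x \<longrightarrow> y \<in> A \<longrightarrow> (\<exists>z\<in>X. R y z \<and> z \<in> A \<inter> B)}"

definition frame_closure :: "'x set \<Rightarrow> ('x \<Rightarrow> 'x \<Rightarrow> bool) \<Rightarrow> 'x set \<Rightarrow> 'x set" where
  "frame_closure X R A = frame_imp X R X A"

definition frame_fixpoints :: "'x set \<Rightarrow> ('x \<Rightarrow> 'x \<Rightarrow> bool) \<Rightarrow> 'x set set" where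
  "frame_fixpoints X R = {A. A \<subseteq> X \<and> frame_closure X R A = A}"

definition frame_algebra :: "'x set \<Rightarrow> ('x \<Rightarrow> 'x \<Rightarrow> bool) \<Rightarrow> 'x set lat_algebra" where
  "frame_algebra X R =
     \<lparr>Carrier = frame_fixpoints X R,
      Meet = (\<inter>),
      Join = (\<lambda>A B. frame_closure X R (A \<union> B)),
      Top = X,
      Bot = frame_closure X R {},
      Imp = frame_imp X R\<rparr>"

text \<open>The operations of \<open>frame_algebra\<close> stay inside the carrier, and the lattice
  operations are those of the inclusion order on the fixpoints.\<close>

lemma frame_closure_extensive: "A \<subseteq> X \<Longrightarrow> A \<subseteq> frame_closure X R A"
  unfolding frame_closure_def frame_imp_def by blast

lemma frame_closure_mono: "A \<subseteq> B \<Longrightarrow> frame_closure X R A \<subseteq> frame_closure X R B"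
  unfolding frame_closure_def frame_imp_def by blast

lemma frame_closure_subset: "frame_closure X R A \<subseteq> X"
  unfolding frame_closure_def frame_imp_def by blast

lemma frame_imp_fixpoint: "frame_imp X R A B \<in> frame_fixpoints X R"
proof -
  have "frame_closure X R (frame_imp X R A B) \<subseteq> frame_imp X R A B"
    unfolding frame_closure_def frame_imp_def by blast
  moreover have "frame_imp X R A B \<subseteq> X"
    unfolding frame_imp_def by blast
  ultimately show ?thesis
    unfolding frame_fixpoints_def using frame_closure_extensive by blast
qed

lemma frame_closure_fixpoint: "frame_closure X R A \<in> frame_fixpoints X R"
  unfolding frame_closure_def by (rule frame_imp_fixpoint)

lemma frame_Int_fixpoint:
  assumes "A \<in> frame_fixpoints X R" "B \<in> frame_fixpoints X R"
  shows "A \<inter> B \<in> frame_fixpoints X R"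
proof -
  have "frame_closure X R (A \<inter> B) \<subseteq> A \<inter> B"
    using assms frame_closure_mono[of "A \<inter> B" A X R] frame_closure_mono[of "A \<inter> B" B X R]
    unfolding frame_fixpoints_def by blast
  then show ?thesis
    using assms frame_closure_extensive[of "A \<inter> B" X R] unfolding frame_fixpoints_def by blast
qed

lemma frame_top_fixpoint: "X \<in> frame_fixpoints X R"
  using frame_closure_extensive[of X X R] frame_closure_subset[of X R X]
  unfolding frame_fixpoints_def by blast

lemma frame_join_upper:
  assumes "A \<in> frame_fixpoints X R" "B \<in> frame_fixpoints X R"
  shows "A \<union> B \<subseteq> frame_closure X R (A \<union> B)"
  using assms frame_closure_extensive[of "A \<union> B" X R] unfolding frame_fixpoints_def by blast

lemma frame_closure_least:
  assumes "A \<subseteq> C" "C \<in> frame_fixpoints X R"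
  shows "frame_closure X R A \<subseteq> C"
  using assms frame_closure_mono[of A C X R] unfolding frame_fixpoints_def by blast

text \<open>Filters and ideals are nonempty but need not be proper.\<close>

definition lat_filter :: "'a::bounded_lattice set \<Rightarrow> bool" where
  "lat_filter F \<longleftrightarrow>
     F \<noteq> {} \<and> (\<forall>a\<in>F. \<forall>b. a \<le> b \<longrightarrow> b \<in> F) \<and> (\<forall>a\<in>F. \<forall>b\<in>F. inf a b \<in> F)"

definition lat_ideal :: "'a::bounded_lattice set \<Rightarrow> bool" where
  "lat_ideal I \<longleftrightarrow>
     I \<noteq> {} \<and> (\<forall>a\<in>I. \<forall>b. b \<le> a \<longrightarrow> b \<in> I) \<and> (\<forall>a\<in>I. \<forall>b\<in>I. sup a b \<in> I)"

definition consonant_pairs ::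
  "('a::bounded_lattice \<Rightarrow> 'a \<Rightarrow> 'a) \<Rightarrow> ('a set \<times> 'a set) set" where
  "consonant_pairs imp =
     {(F, I). lat_filter F \<and> lat_ideal I \<and>
        (\<forall>a b. a \<in> F \<longrightarrow> inf a b \<in> I \<longrightarrow> imp a b \<in> I)}"

definition pair_rel :: "'a set \<times> 'a set \<Rightarrow> 'a set \<times> 'a set \<Rightarrow> bool" where
  "pair_rel p q \<longleftrightarrow> snd p \<inter> fst q = {}"

definition FI_algebra ::
  "('a::bounded_lattice \<Rightarrow> 'a \<Rightarrow> 'a) \<Rightarrow> ('a set \<times> 'a set) set lat_algebra" where
  "FI_algebra imp = frame_algebra (consonant_pairs imp) pair_rel"

definition hat ::
  "('a::bounded_lattice \<Rightarrow> 'a \<Rightarrow> 'a) \<Rightarrow> 'a \<Rightarrow> ('a set \<times> 'a set) set" where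
  "hat imp a = {(F, I) \<in> consonant_pairs imp. a \<in> F}"

definition FI_space ::
  "('a::bounded_lattice \<Rightarrow> 'a \<Rightarrow> 'a) \<Rightarrow> ('a set \<times> 'a set) topology" where
  "FI_space imp = topology_generated_by (range (hat imp))"

lemma hat_top: "hat imp top = consonant_pairs imp"
  unfolding hat_def consonant_pairs_def lat_filter_def by auto

lemma topspace_FI_space: "topspace (FI_space imp) = consonant_pairs imp"
proof -
  have "(\<Union>a. hat imp a) = consonant_pairs imp"
    using hat_top[of imp] by (auto simp: hat_def)
  then show ?thesis
    unfolding FI_space_def by (simp add: topology_generated_by_topspace)
qed

definition compact_open_fixpoints ::
  "('a::bounded_lattice \<Rightarrow> 'a \<Rightarrow> 'a) \<Rightarrow> ('a set \<times> 'a set) set set" where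
  "compact_open_fixpoints imp =
     {U \<in> Carrier (FI_algebra imp). compactin (FI_space imp) U \<and> openin (FI_space imp) U}"

end

theory Submission
  imports Defs
begin

text \<open>Each homomorphism clause needs witnesses among three kinds of consonant pairs:
  \<open>(\<up>a, L)\<close> lies in \<open>hat a\<close> and sees every \<open>(F, I)\<close> with \<open>a \<notin> I\<close>; \<open>(\<up>1, \<down>a)\<close> separates
  a point outside \<open>hat a\<close> from \<open>hat a\<close>; and \<open>(\<up>a, \<down>(a \<leadsto> b))\<close>, whose consonance is what the
  last preconditional axiom provides, refutes \<open>hat a \<rightarrow> hat b\<close> at points omitting \<open>a \<leadsto> b\<close>.
  For compactness, \<open>(\<up>a, L)\<close> is a least point of \<open>hat a\<close>: an open set containing it contains
  \<open>hat a\<close>. Conversely, a compact open fixpoint is a finite union of sets \<open>hat b\<close>, so it is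
  \<open>hat\<close> of the join of the \<open>b\<close>s.\<close>

section \<open>Filters, ideals and consonant pairs\<close>

lemma lat_filter_atLeast: "lat_filter {a..}"
  unfolding lat_filter_def by (auto intro: order_trans)

lemma lat_ideal_atMost: "lat_ideal {..a}"
  unfolding lat_ideal_def by (auto intro: order_trans)

lemma lat_ideal_UNIV: "lat_ideal UNIV"
  unfolding lat_ideal_def by auto

lemma lat_filter_upD: "lat_filter F \<Longrightarrow> a \<in> F \<Longrightarrow> a \<le> b \<Longrightarrow> b \<in> F"
  unfolding lat_filter_def by blast

lemma lat_filter_inf_iff: "lat_filter F \<Longrightarrow> inf a b \<in> F \<longleftrightarrow> a \<in> F \<and> b \<in> F"
  using lat_filter_upD[of F "inf a b" a] lat_filter_upD[of F "inf a b" b]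
  unfolding lat_filter_def by auto

lemma lat_ideal_downD: "lat_ideal I \<Longrightarrow> a \<in> I \<Longrightarrow> b \<le> a \<Longrightarrow> b \<in> I"
  unfolding lat_ideal_def by blast

lemma lat_ideal_supD: "lat_ideal I \<Longrightarrow> a \<in> I \<Longrightarrow> b \<in> I \<Longrightarrow> sup a b \<in> I"
  unfolding lat_ideal_def by blast

lemma lat_ideal_bot: "lat_ideal I \<Longrightarrow> bot \<in> I"
  unfolding lat_ideal_def using bot_least by blast

lemma consonant_pairsD:
  assumes "(F, I) \<in> consonant_pairs imp"
  shows "lat_filter F" "lat_ideal I" "a \<in> F \<Longrightarrow> inf a b \<in> I \<Longrightarrow> imp a b \<in> I"
  using assms unfolding consonant_pairs_def by auto

lemma hat_iff: "(F, I) \<in> hat imp a \<longleftrightarrow> (F, I) \<in> consonant_pairs imp \<and> a \<in> F"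
  unfolding hat_def by auto

lemma hat_subset: "hat imp a \<subseteq> consonant_pairs imp"
  unfolding hat_def by auto

lemma consonant_atLeast_UNIV: "({a..}, UNIV) \<in> consonant_pairs imp"
  unfolding consonant_pairs_def by (simp add: lat_filter_atLeast lat_ideal_UNIV)

lemma atLeast_UNIV_in_hat: "({a..}, UNIV) \<in> hat imp b \<longleftrightarrow> a \<le> b"
  by (simp add: hat_iff consonant_atLeast_UNIV)

text \<open>The witness is \<open>({a..}, UNIV)\<close>: a down-closed \<open>J\<close> that omits
  \<open>a\<close> meets no element above \<open>a\<close>.\<close>

lemma exists_successor_in_hat:
  assumes "lat_ideal J" "a \<notin> J"
  shows "\<exists>z\<in>consonant_pairs imp. pair_rel (G, J) z \<and> z \<in> hat imp a"
proof (intro bexI conjI)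
  show "pair_rel (G, J) ({a..}, UNIV)"
    using assms by (auto simp: pair_rel_def dest: lat_ideal_downD)
  show "({a..}, UNIV) \<in> hat imp a"
    by (simp add: atLeast_UNIV_in_hat)
qed (rule consonant_atLeast_UNIV)

lemma hat_mono: "a \<le> b \<Longrightarrow> hat imp a \<subseteq> hat imp b"
  unfolding hat_def consonant_pairs_def lat_filter_def by blast

lemma hat_inf: "hat imp (inf a b) = hat imp a \<inter> hat imp b"
  unfolding hat_def consonant_pairs_def by (auto simp: lat_filter_inf_iff)

text \<open>The points \<open>({a..}, UNIV)\<close> make \<open>hat\<close> reflect the order, so
  equal values force \<open>a \<le> b\<close> and \<open>b \<le> a\<close>.\<close>

lemma inj_hat: "inj (hat imp)"
proof (rule injI)
  fix a b assume eq: "hat imp a = hat imp b"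
  have "({a..}, UNIV) \<in> hat imp b" "({b..}, UNIV) \<in> hat imp a"
    using atLeast_UNIV_in_hat[of a imp a] atLeast_UNIV_in_hat[of b imp b] eq by auto
  then show "a = b"
    unfolding atLeast_UNIV_in_hat by (rule order_antisym)
qed

section \<open>The topology generated by the sets \<open>hat a\<close>\<close>

text \<open>By \<open>hat_inf\<close> the generating sets are closed under binary intersection, so
  this subbasis is already a base.\<close>

lemma openin_FI_space_hat_base:
  assumes "openin (FI_space imp) U" "(F, I) \<in> U"
  obtains b where "b \<in> F" "hat imp b \<subseteq> U"
proof -
  have "generate_topology_on (range (hat imp)) U"
    using assms(1) by (simp add: FI_space_def openin_topology_generated_by_iff)
  then have "\<forall>p\<in>U. \<exists>b. p \<in> hat imp b \<and> hat imp b \<subseteq> U"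
  proof induction
    case (Int V W)
    show ?case
    proof
      fix p assume "p \<in> V \<inter> W"
      with Int.IH obtain b c where "p \<in> hat imp b" "hat imp b \<subseteq> V" "p \<in> hat imp c" "hat imp c \<subseteq> W"
        by blast
      then have "p \<in> hat imp (inf b c) \<and> hat imp (inf b c) \<subseteq> V \<inter> W"
        by (auto simp: hat_inf)
      then show "\<exists>b. p \<in> hat imp b \<and> hat imp b \<subseteq> V \<inter> W" ..
    qed
  next
    case (UN K)
    then show ?case by (meson Union_iff Union_upper order_trans)
  qed auto
  with assms(2) that show thesis
    by (fastforce simp: hat_iff)
qed

lemma openin_hat: "openin (FI_space imp) (hat imp a)"
  unfolding FI_space_def by (rule topology_generated_by_Basis) simp

lemma compactin_hat: "compactin (FI_space imp) (hat imp a)"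
  unfolding compactin_def
proof (intro conjI allI impI)
  show "hat imp a \<subseteq> topspace (FI_space imp)"
    by (simp add: topspace_FI_space hat_subset)
  fix \<U> assume cover: "Ball \<U> (openin (FI_space imp)) \<and> hat imp a \<subseteq> \<Union> \<U>"
  then obtain U where U: "U \<in> \<U>" "({a..}, UNIV) \<in> U"
    using atLeast_UNIV_in_hat[of a imp a] by auto
  then obtain b where "b \<in> {a..}" "hat imp b \<subseteq> U"
    using cover openin_FI_space_hat_base by metis
  \<comment> \<open>From \<open>a \<le> b\<close>,
    \<open>hat a \<subseteq> hat b \<subseteq> U\<close>; this single member of the cover
    suffices.\<close>
  then have "hat imp a \<subseteq> U"
    using hat_mono by fastforce
  with U(1) show "\<exists>\<F>. finite \<F> \<and> \<F> \<subseteq> \<U> \<and> hat imp a \<subseteq> \<Union> \<F>"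
    by (intro exI[of _ "{U}"]) auto
qed

section \<open>The homomorphism clauses\<close>

context preconditional
begin

lemma imp_mono_right: "b \<le> c \<Longrightarrow> a \<leadsto> b \<le> a \<leadsto> c"
  using imp_inf_le[of a c b] by (simp add: inf_absorb2)

lemma consonant_atLeast_imp: "({a..}, {..a \<leadsto> b}) \<in> consonant_pairs (\<leadsto>)"
proof -
  have "c \<leadsto> d \<le> a \<leadsto> b" if "a \<le> c" "inf c d \<le> a \<leadsto> b" for c d
  proof -
    have "c \<leadsto> d \<le> c \<leadsto> inf c d" by (rule imp_le_imp_inf)
    \<comment> \<open>As \<open>a \<le> c\<close>, \<open>a\<close> equals \<open>inf c a\<close>;
      in this form \<open>a \<leadsto> b\<close> fits \<open>imp_imp_le\<close>.\<close>
    also have "\<dots> \<le> c \<leadsto> (inf c a \<leadsto> b)"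
      using that by (intro imp_mono_right) (simp add: inf_absorb2)
    also have "\<dots> \<le> inf c a \<leadsto> b" by (rule imp_imp_le)
    finally show ?thesis using that by (simp add: inf_absorb2)
  qed
  then show ?thesis
    unfolding consonant_pairs_def by (simp add: lat_filter_atLeast lat_ideal_atMost)
qed

text \<open>Since \<open>top \<leadsto> a = a\<close>, this is an instance of the previous
  lemma.\<close>

lemma consonant_top_atMost: "({top..}, {..a}) \<in> consonant_pairs (\<leadsto>)"
proof -
  have "top \<leadsto> a = a"
    using top_imp[of a] inf_le_imp[of top a] by (simp add: order_antisym)
  then show ?thesis
    using consonant_atLeast_imp[of top a] by simp
qed

lemma hat_fixpoint: "hat (\<leadsto>) a \<in> frame_fixpoints (consonant_pairs (\<leadsto>)) pair_rel"
proof -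
  let ?X = "consonant_pairs (\<leadsto>)"
  have "(F, I) \<in> hat (\<leadsto>) a" if FI: "(F, I) \<in> frame_closure ?X pair_rel (hat (\<leadsto>) a)" for F I
  proof (rule ccontr)
    have X: "(F, I) \<in> ?X"
      using FI by (auto simp: frame_closure_def frame_imp_def)
    assume "(F, I) \<notin> hat (\<leadsto>) a"
    \<comment> \<open>\<open>F\<close> is up-closed and omits \<open>a\<close>, so it misses
      \<open>{..a}\<close>. This predecessor sees no point of \<open>hat a\<close>, whose filters
      all contain \<open>a\<close>.\<close>
    then have "pair_rel ({top..}, {..a}) (F, I)"
      using X by (auto simp: hat_iff pair_rel_def dest: consonant_pairsD(1) lat_filter_upD)
    then obtain z where "pair_rel ({top..}, {..a}) z" "z \<in> hat (\<leadsto>) a"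
      using FI consonant_top_atMost unfolding frame_closure_def frame_imp_def by blast
    then show False
      by (auto simp: pair_rel_def hat_def)
  qed
  then have "frame_closure ?X pair_rel (hat (\<leadsto>) a) \<subseteq> hat (\<leadsto>) a"
    by auto
  then show ?thesis
    using frame_closure_extensive[OF hat_subset] hat_subset
    unfolding frame_fixpoints_def by blast
qed

text \<open>Every ideal contains \<open>bot\<close>, so a point whose filter contains
  \<open>bot\<close> has no predecessors and lies in the closure vacuously.\<close>

lemma hat_bot: "hat (\<leadsto>) bot = frame_closure (consonant_pairs (\<leadsto>)) pair_rel {}"
proof
  show "hat (\<leadsto>) bot \<subseteq> frame_closure (consonant_pairs (\<leadsto>)) pair_rel {}"
    unfolding frame_closure_def frame_imp_def hat_def consonant_pairs_def pair_rel_def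
    by (auto dest: lat_ideal_bot)
qed (rule frame_closure_least[OF empty_subsetI hat_fixpoint])

text \<open>An ideal omitting \<open>sup a b\<close> omits \<open>a\<close> or \<open>b\<close>,
  which gives a successor in one of the two sets. The other inclusion holds because
  \<open>hat (sup a b)\<close> is a fixpoint containing both.\<close>

lemma hat_sup:
  "hat (\<leadsto>) (sup a b) =
     frame_closure (consonant_pairs (\<leadsto>)) pair_rel (hat (\<leadsto>) a \<union> hat (\<leadsto>) b)"
proof
  let ?X = "consonant_pairs (\<leadsto>)"
  have "\<exists>z\<in>?X. pair_rel (G, J) z \<and> z \<in> hat (\<leadsto>) a \<union> hat (\<leadsto>) b"
    if "(F, I) \<in> hat (\<leadsto>) (sup a b)" "(G, J) \<in> ?X" "pair_rel (G, J) (F, I)" for F I G J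
  proof -
    have J: "lat_ideal J" using that(2) by (rule consonant_pairsD)
    moreover have "sup a b \<notin> J"
      using that by (auto simp: hat_iff pair_rel_def)
    ultimately have "a \<notin> J \<or> b \<notin> J"
      by (auto dest: lat_ideal_supD)
    with J show ?thesis
      using exists_successor_in_hat[of J] by blast
  qed
  then show "hat (\<leadsto>) (sup a b) \<subseteq> frame_closure ?X pair_rel (hat (\<leadsto>) a \<union> hat (\<leadsto>) b)"
    using hat_subset[of "(\<leadsto>)" "sup a b"] unfolding frame_closure_def frame_imp_def by fast
  show "frame_closure ?X pair_rel (hat (\<leadsto>) a \<union> hat (\<leadsto>) b) \<subseteq> hat (\<leadsto>) (sup a b)"
    using hat_mono[of a "sup a b"] hat_mono[of b "sup a b"]
    by (intro frame_closure_least hat_fixpoint) simp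
qed

lemma hat_imp:
  "hat (\<leadsto>) (a \<leadsto> b) =
     frame_imp (consonant_pairs (\<leadsto>)) pair_rel (hat (\<leadsto>) a) (hat (\<leadsto>) b)"
proof
  let ?X = "consonant_pairs (\<leadsto>)"
  have "\<exists>z\<in>?X. pair_rel (G, J) z \<and> z \<in> hat (\<leadsto>) a \<inter> hat (\<leadsto>) b"
    if "(F, I) \<in> hat (\<leadsto>) (a \<leadsto> b)" "(G, J) \<in> hat (\<leadsto>) a" "pair_rel (G, J) (F, I)" for F I G J
  proof -
    have GJ: "(G, J) \<in> ?X" "a \<in> G"
      using that(2) by (auto simp: hat_iff)
    have "a \<leadsto> b \<notin> J"
      using that by (auto simp: hat_iff pair_rel_def)
    \<comment> \<open>Consonance of \<open>(G, J)\<close>, read contrapositively.\<close>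
    then have "inf a b \<notin> J"
      using consonant_pairsD(3)[OF GJ] by blast
    then show ?thesis
      using exists_successor_in_hat[OF consonant_pairsD(2)[OF GJ(1)]] by (metis hat_inf)
  qed
  then show "hat (\<leadsto>) (a \<leadsto> b) \<subseteq> frame_imp ?X pair_rel (hat (\<leadsto>) a) (hat (\<leadsto>) b)"
    using hat_subset[of "(\<leadsto>)" "a \<leadsto> b"] unfolding frame_imp_def by fast
  show "frame_imp ?X pair_rel (hat (\<leadsto>) a) (hat (\<leadsto>) b) \<subseteq> hat (\<leadsto>) (a \<leadsto> b)"
  proof clarify
    fix F I assume FI: "(F, I) \<in> frame_imp ?X pair_rel (hat (\<leadsto>) a) (hat (\<leadsto>) b)"
    then have X: "(F, I) \<in> ?X"
      by (auto simp: frame_imp_def)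
    show "(F, I) \<in> hat (\<leadsto>) (a \<leadsto> b)"
    proof (rule ccontr)
      let ?y = "({a..}, {..a \<leadsto> b})"
      assume "(F, I) \<notin> hat (\<leadsto>) (a \<leadsto> b)"
      then have "pair_rel ?y (F, I)"
        using X by (auto simp: hat_iff pair_rel_def dest: consonant_pairsD(1) lat_filter_upD)
      moreover have "?y \<in> hat (\<leadsto>) a"
        by (simp add: hat_iff consonant_atLeast_imp)
      ultimately obtain z where "pair_rel ?y z" "z \<in> hat (\<leadsto>) (inf a b)"
        using FI consonant_atLeast_imp unfolding frame_imp_def hat_inf by blast
      \<comment> \<open>\<open>inf a b\<close> is in the filter of \<open>z\<close> and, by
        \<open>inf_le_imp\<close>, also in the ideal of \<open>?y\<close>.\<close>
      then show False
        using inf_le_imp[of a b] by (auto simp: pair_rel_def hat_def)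
    qed
  qed
qed

lemma lat_hom_hat: "lat_hom (type_algebra (\<leadsto>)) (FI_algebra (\<leadsto>)) (hat (\<leadsto>))"
  unfolding lat_hom_def type_algebra_def FI_algebra_def frame_algebra_def
  by (auto simp: hat_fixpoint hat_top hat_bot hat_inf hat_sup hat_imp)

section \<open>Compact open fixpoints\<close>

text \<open>\<open>s\<close> is the join of \<open>B\<close>, starting from \<open>bot\<close>. The
  union need not be a fixpoint, but \<open>U\<close> is, so it also contains the closures that form
  \<open>hat bot\<close> and each \<open>hat (sup b s)\<close>.\<close>

lemma finite_union_hats_bounded:
  assumes "U \<in> frame_fixpoints (consonant_pairs (\<leadsto>)) pair_rel"
    and "finite B" "\<And>b. b \<in> B \<Longrightarrow> hat (\<leadsto>) b \<subseteq> U"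
  shows "\<exists>s. (\<Union>b\<in>B. hat (\<leadsto>) b) \<subseteq> hat (\<leadsto>) s \<and> hat (\<leadsto>) s \<subseteq> U"
  using assms(2,3)
proof (induction B rule: finite_induct)
  case empty
  have "hat (\<leadsto>) bot \<subseteq> U"
    unfolding hat_bot by (rule frame_closure_least[OF empty_subsetI assms(1)])
  then show ?case by auto
next
  case (insert b B)
  obtain s where s: "(\<Union>b\<in>B. hat (\<leadsto>) b) \<subseteq> hat (\<leadsto>) s" "hat (\<leadsto>) s \<subseteq> U"
    using insert.IH[OF insert.prems] by auto
  have "hat (\<leadsto>) (sup b s) \<subseteq> U"
    unfolding hat_sup using insert.prems s(2) assms(1) by (intro frame_closure_least) auto
  moreover have "(\<Union>b\<in>insert b B. hat (\<leadsto>) b) \<subseteq> hat (\<leadsto>) (sup b s)"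
    using subset_trans[OF s(1) hat_mono[OF sup_ge2]] by (simp add: hat_mono)
  ultimately show ?case
    by (intro exI[of _ "sup b s"]) simp
qed

lemma compact_open_fixpoints_eq: "compact_open_fixpoints (\<leadsto>) = range (hat (\<leadsto>))"
proof
  show "range (hat (\<leadsto>)) \<subseteq> compact_open_fixpoints (\<leadsto>)"
    by (auto simp: compact_open_fixpoints_def FI_algebra_def frame_algebra_def
        hat_fixpoint openin_hat compactin_hat)
  show "compact_open_fixpoints (\<leadsto>) \<subseteq> range (hat (\<leadsto>))"
  proof
    fix U assume "U \<in> compact_open_fixpoints (\<leadsto>)"
    then have U: "U \<in> frame_fixpoints (consonant_pairs (\<leadsto>)) pair_rel"
      "compactin (FI_space (\<leadsto>)) U" "openin (FI_space (\<leadsto>)) U"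
      by (auto simp: compact_open_fixpoints_def FI_algebra_def frame_algebra_def)
    let ?C = "{b. hat (\<leadsto>) b \<subseteq> U}"
    have "U \<subseteq> \<Union> (hat (\<leadsto>) ` ?C)"
    proof clarify
      fix F I assume FI: "(F, I) \<in> U"
      with U(3) obtain b where "b \<in> F" "hat (\<leadsto>) b \<subseteq> U"
        by (rule openin_FI_space_hat_base)
      moreover have "(F, I) \<in> consonant_pairs (\<leadsto>)"
        using FI U(1) by (auto simp: frame_fixpoints_def)
      ultimately show "(F, I) \<in> \<Union> (hat (\<leadsto>) ` ?C)"
        by (auto simp: hat_iff)
    qed
    then have "\<exists>\<F>. finite \<F> \<and> \<F> \<subseteq> hat (\<leadsto>) ` ?C \<and> U \<subseteq> \<Union> \<F>"
      by (intro compactinD[OF U(2)]) (auto simp: openin_hat)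
    then obtain \<F> where \<F>: "finite \<F>" "\<F> \<subseteq> hat (\<leadsto>) ` ?C" "U \<subseteq> \<Union> \<F>"
      by blast
    obtain B where "finite B" "B \<subseteq> ?C" "\<F> = hat (\<leadsto>) ` B"
      using finite_subset_image[OF \<F>(1,2)] by blast
    with \<F>(3) have B: "finite B" "B \<subseteq> ?C" "U \<subseteq> \<Union> (hat (\<leadsto>) ` B)"
      by simp_all
    then obtain s where "\<Union> (hat (\<leadsto>) ` B) \<subseteq> hat (\<leadsto>) s" "hat (\<leadsto>) s \<subseteq> U"
      using finite_union_hats_bounded[OF U(1) B(1)] B(2) by blast
    \<comment> \<open>\<open>U\<close> is inside the finite union, which is inside
      \<open>hat s\<close>, which is inside \<open>U\<close>.\<close>
    with B(3) have "U = hat (\<leadsto>) s" by blast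
    then show "U \<in> range (hat (\<leadsto>))" by simp
  qed
qed

end

section \<open>Images of homomorphisms, and the conclusion\<close>

lemma lat_subalgebra_image_hom:
  assumes "lat_hom A B f"
    and "Top A \<in> Carrier A" "Bot A \<in> Carrier A"
    and "\<And>x y. x \<in> Carrier A \<Longrightarrow> y \<in> Carrier A \<Longrightarrow>
      Meet A x y \<in> Carrier A \<and> Join A x y \<in> Carrier A \<and> Imp A x y \<in> Carrier A"
  shows "lat_subalgebra (f ` Carrier A) B"
proof -
  have "Top B \<in> f ` Carrier A" "Bot B \<in> f ` Carrier A"
    using assms(1-3) unfolding lat_hom_def by (metis imageI)+
  moreover have "Meet B (f x) (f y) \<in> f ` Carrier A \<and> Join B (f x) (f y) \<in> f ` Carrier A
      \<and> Imp B (f x) (f y) \<in> f ` Carrier A" if "x \<in> Carrier A" "y \<in> Carrier A" for x y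
    using assms(1) assms(4)[OF that] that unfolding lat_hom_def by (metis imageI)
  ultimately show ?thesis
    using assms(1) unfolding lat_subalgebra_def lat_hom_def by blast
qed

lemma lat_iso_image_hom:
  assumes "lat_hom A B f" "inj_on f (Carrier A)"
  shows "lat_iso A (B\<lparr>Carrier := f ` Carrier A\<rparr>) f"
  using assms unfolding lat_iso_def lat_hom_def bij_betw_def by simp

theorem theorem2:
  fixes imp :: "'a::bounded_lattice \<Rightarrow> 'a \<Rightarrow> 'a"
  assumes "preconditional imp"
  shows "lat_embedding (type_algebra imp) (FI_algebra imp) (hat imp)
       \<and> lat_subalgebra (compact_open_fixpoints imp) (FI_algebra imp)
       \<and> lat_iso (type_algebra imp)
           ((FI_algebra imp)\<lparr>Carrier := compact_open_fixpoints imp\<rparr>) (hat imp)"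
proof -
  interpret preconditional imp by fact
  have carrier: "Carrier (type_algebra imp) = UNIV"
    by (simp add: type_algebra_def)
  show ?thesis
    \<comment> \<open>Once the compact open fixpoints are identified with the range of
      \<open>hat\<close>, the last two claims concern the image of an injective
      homomorphism.\<close>
    using lat_hom_hat inj_hat[of imp] lat_subalgebra_image_hom[OF lat_hom_hat]
      lat_iso_image_hom[OF lat_hom_hat]
    by (simp add: lat_embedding_def compact_open_fixpoints_eq carrier)
qed

end
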